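(* Let $(\mathcal{P},\leq)$ be a poset and let $(\mathcal{Q},\leq)$ be a poset with a zero element $0$ and with a join-dense subset $B\subset\mathcal{Q}$. For any order-preserving map $\mathbf{F}:\mathcal{P}\to\mathcal{Q}$, one has $$\mathbf{F}=\bigvee\{\mathbf{F}_b : b\in B\},$$ where the join is taken in the poset $[\mathcal{P},\mathcal{Q}]$ of order-preserving maps and $\mathbf{F}_b$ is the $b$-part of $\mathbf{F}$.
   Context: Posets are nonempty. A zero element of a poset is an element $0$ with $0\leq q$ for all $q$. A subset $B\subset\mathcal{Q}$ is join-dense if every element of $\mathcal{Q}$ is the join (least upper bound) of some subset of $B$ (the join of the empty set is the zero element). $[\mathcal{P},\mathcal{Q}]$ is the set of order-preserving maps $\mathcal{P}\to\mathcal{Q}$, ordered pointwise: $\mathbf{F}\leq\mathbf{G}$ iff $\mathbf{F}(p)\leq\mathbf{G}(p)$ for all $p\in\mathcal{P}$. For $b\in\mathcal{Q}$, $b^\uparrow:=\{q\in\mathcal{Q}: b\leq q\}$. For an upper set $U\subset\mathcal{P}$ (i.e. $p\in U$ and $p\leq p'$ imply $p'\in U$) and $q\in\mathcal{Q}$, the indicator map $\mathbf{I}^U_q:\mathcal{P}\to\mathcal{Q}$ sends $p$ to $q$ if $p\in U$ and to $0$ otherwise. The $b$-part of $\mathbf{F}\in[\mathcal{P},\mathcal{Q}]$ is $\mathbf{F}_b:=\mathbf{I}_b^{\mathbf{F}^{-1}(b^\uparrow)}$, where $\mathbf{F}^{-1}(b^\uparrow)=\{p\in\mathcal{P}: b\leq\mathbf{F}(p)\}$.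 *)

theory Defs
  imports "HOL-Algebra.Order" "HOL-Library.FuncSet"
begin

text \<open>
  The poset \<open>[P, Q]\<close>. Maps are extensional, so that pointwise equality on the carrier of \<open>P\<close>
  is equality of functions and the pointwise order is antisymmetric.
\<close>

definition map_poset ::
  "('p, 'm) gorder_scheme \<Rightarrow> ('q, 'n) gorder_scheme \<Rightarrow> ('p \<Rightarrow> 'q) gorder" where
  "map_poset P Q =
    \<lparr>carrier = {F \<in> carrier P \<rightarrow>\<^sub>E carrier Q. isotone P Q F},
     eq = (=),
     le = (\<lambda>F G. \<forall>p\<in>carrier P. F p \<sqsubseteq>\<^bsub>Q\<^esub> G p)\<rparr>"

definition join_dense :: "('q, 'n) gorder_scheme \<Rightarrow> 'q set \<Rightarrow> bool" where
  "join_dense Q B \<longleftrightarrow> B \<subseteq> carrier Q \<and> (\<forall>q\<in>carrier Q. \<exists>S\<subseteq>B. is_lub Q q S)"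

definition principal_up :: "('q, 'n) gorder_scheme \<Rightarrow> 'q \<Rightarrow> 'q set" where
  "principal_up Q b = {q \<in> carrier Q. b \<sqsubseteq>\<^bsub>Q\<^esub> q}"

definition upper_set :: "('p, 'm) gorder_scheme \<Rightarrow> 'p set \<Rightarrow> bool" where
  "upper_set P U \<longleftrightarrow>
    U \<subseteq> carrier P \<and> (\<forall>p\<in>U. \<forall>p'\<in>carrier P. p \<sqsubseteq>\<^bsub>P\<^esub> p' \<longrightarrow> p' \<in> U)"

text \<open>In the following two definitions, \<open>z\<close> is the zero element of the target poset.\<close>

definition indicator_map :: "('p, 'm) gorder_scheme \<Rightarrow> 'q \<Rightarrow> 'p set \<Rightarrow> 'q \<Rightarrow> 'p \<Rightarrow> 'q" where
  "indicator_map P z U q = (\<lambda>p\<in>carrier P. if p \<in> U then q else z)"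

definition part_at ::
  "('p, 'm) gorder_scheme \<Rightarrow> ('q, 'n) gorder_scheme \<Rightarrow> 'q \<Rightarrow> ('p \<Rightarrow> 'q) \<Rightarrow> 'q \<Rightarrow> 'p \<Rightarrow> 'q" where
  "part_at P Q z F b = indicator_map P z (F -` principal_up Q b \<inter> carrier P) b"

text \<open>
  \<open>map_poset P Q\<close> is a partial order, so joins in it are unique. It contains all \<open>b\<close>-parts; this
  matters because \<^const>\<open>Upper\<close> ignores elements outside the carrier.
\<close>

lemma partial_order_map_poset:
  assumes "partial_order P" "partial_order Q"
  shows "partial_order (map_poset P Q)"
proof -
  interpret Q: partial_order Q by fact
  show ?thesis
  proof (unfold_locales, goal_cases)
    case (5 F G)
    have "F p = G p" if "p \<in> carrier P" for p
      using 5 that by (auto simp: map_poset_def PiE_mem intro: Q.le_antisym)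
    then show ?case using 5 by (auto simp: map_poset_def intro: PiE_ext)
  next
    case (6 F G H)
    then show ?case
      unfolding map_poset_def by (auto dest: PiE_mem intro: Q.le_trans)
  qed (auto simp: map_poset_def PiE_mem)
qed

lemma indicator_map_closed:
  assumes "partial_order P" "partial_order Q" "least Q z (carrier Q)"
    and "upper_set P U" "q \<in> carrier Q"
  shows "indicator_map P z U q \<in> carrier (map_poset P Q)"
proof -
  interpret P: partial_order P by fact
  interpret Q: partial_order Q by fact
  show ?thesis
    using assms P.weak_partial_order_axioms Q.weak_partial_order_axioms
    by (auto simp: map_poset_def indicator_map_def isotone_def upper_set_def least_def)
qed

lemma upper_set_vimage_principal_up:
  assumes "F \<in> carrier (map_poset P Q)" "b \<in> carrier Q"
  shows "upper_set P (F -` principal_up Q b \<inter> carrier P)"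
proof -
  interpret Q: weak_partial_order Q
    using assms by (simp add: map_poset_def isotone_def)
  show ?thesis
    using assms unfolding upper_set_def principal_up_def map_poset_def isotone_def
    by (auto dest: PiE_mem) (meson Q.le_trans PiE_mem)
qed

lemma part_at_closed:
  assumes "partial_order P" "partial_order Q" "least Q z (carrier Q)"
    and "F \<in> carrier (map_poset P Q)" "b \<in> carrier Q"
  shows "part_at P Q z F b \<in> carrier (map_poset P Q)"
  unfolding part_at_def
  using assms by (intro indicator_map_closed upper_set_vimage_principal_up)

end

theory Submission
  imports Defs
begin

text \<open>
  Evaluated at a point \<open>p\<close>, the part of \<open>F\<close> at \<open>b\<close> is \<open>b\<close> if \<open>b\<close> lies below \<open>F p\<close>, and the zero
  element otherwise. Either value lies below \<open>F p\<close>, so \<open>F\<close> is an upper bound of its parts.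
  Conversely, the value at \<open>p\<close> of an upper bound \<open>G\<close> of the parts dominates every \<open>b \<in> B\<close> below
  \<open>F p\<close>. Join-density writes \<open>F p\<close> as the join of some such \<open>b\<close>, hence \<open>F p\<close> lies below \<open>G p\<close>
  (lemma \<open>join_dense_le\<close>).

  The second half reads \<open>b \<sqsubseteq> G p\<close> off \<open>part_at P Q z F b \<sqsubseteq> G\<close>, which the upper bound property gives
  only for parts in the carrier of \<^term>\<open>map_poset P Q\<close>. That they are there is \<open>part_at_closed\<close>.
\<close>

lemma part_at_apply:
  assumes "p \<in> carrier P" "F p \<in> carrier Q"
  shows "part_at P Q z F b p = (if b \<sqsubseteq>\<^bsub>Q\<^esub> F p then b else z)"
  using assms by (simp add: part_at_def indicator_map_def principal_up_def)

text \<open>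
  Some subset of \<open>B\<close> has join \<open>q\<close>. Its members lie below \<open>q\<close>, so \<open>u\<close> is one of its upper bounds.
\<close>

lemma join_dense_le:
  assumes dense: "join_dense Q B" and q: "q \<in> carrier Q" and u: "u \<in> carrier Q"
    and bound: "\<And>b. b \<in> B \<Longrightarrow> b \<sqsubseteq>\<^bsub>Q\<^esub> q \<Longrightarrow> b \<sqsubseteq>\<^bsub>Q\<^esub> u"
  shows "q \<sqsubseteq>\<^bsub>Q\<^esub> u"
proof -
  obtain S where S: "S \<subseteq> B" "S \<subseteq> carrier Q" and lub: "is_lub Q q S"
    using dense q unfolding join_dense_def by blast
  have "b \<sqsubseteq>\<^bsub>Q\<^esub> q" if "b \<in> S" for b
    using lub S that by (auto simp: least_def Upper_def)
  with S u bound have "u \<in> Upper Q S"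
    by (auto simp: Upper_def)
  with lub show ?thesis
    by (simp add: least_def)
qed

theorem proposition3p5:
  fixes P :: "('p, 'm) gorder_scheme" and Q :: "('q, 'n) gorder_scheme"
    and z :: 'q and B :: "'q set" and F :: "'p \<Rightarrow> 'q"
  assumes "partial_order P" and "carrier P \<noteq> {}"
    and "partial_order Q" and "least Q z (carrier Q)"
    and "join_dense Q B"
    and "F \<in> carrier (map_poset P Q)"
  shows "is_lub (map_poset P Q) F {part_at P Q z F b | b. b \<in> B}"
proof -
  let ?parts = "{part_at P Q z F b | b. b \<in> B}"
  have maps: "G p \<in> carrier Q" if "G \<in> carrier (map_poset P Q)" "p \<in> carrier P" for G p
    using that by (auto simp: map_poset_def)
  have zero: "z \<sqsubseteq>\<^bsub>Q\<^esub> q" if "q \<in> carrier Q" for q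
    using assms(4) that by (simp add: least_def)
  have le: "G \<sqsubseteq>\<^bsub>map_poset P Q\<^esub> H \<longleftrightarrow> (\<forall>p\<in>carrier P. G p \<sqsubseteq>\<^bsub>Q\<^esub> H p)" for G H
    by (simp add: map_poset_def)
  have closed: "part_at P Q z F b \<in> carrier (map_poset P Q)" if "b \<in> B" for b
    using assms that by (intro part_at_closed) (auto simp: join_dense_def)
  have "part_at P Q z F b \<sqsubseteq>\<^bsub>map_poset P Q\<^esub> F" for b
    using maps[OF assms(6)] zero by (simp add: le part_at_apply)
  then have "F \<in> Upper (map_poset P Q) ?parts"
    using assms(6) by (auto simp: Upper_def)
  moreover have "F \<sqsubseteq>\<^bsub>map_poset P Q\<^esub> G" if G: "G \<in> Upper (map_poset P Q) ?parts" for G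
    unfolding le
  proof
    fix p assume p: "p \<in> carrier P"
    have G_map: "G \<in> carrier (map_poset P Q)"
      using G by (simp add: Upper_def)
    show "F p \<sqsubseteq>\<^bsub>Q\<^esub> G p"
    proof (rule join_dense_le[OF assms(5) maps[OF assms(6) p] maps[OF G_map p]])
      fix b assume b: "b \<in> B" and below: "b \<sqsubseteq>\<^bsub>Q\<^esub> F p"
      have "part_at P Q z F b \<sqsubseteq>\<^bsub>map_poset P Q\<^esub> G"
        using G closed[OF b] b by (auto simp: Upper_def)
      then have "part_at P Q z F b p \<sqsubseteq>\<^bsub>Q\<^esub> G p"
        using p by (simp add: le)
      then show "b \<sqsubseteq>\<^bsub>Q\<^esub> G p"
        using below p maps[OF assms(6) p] by (simp add: part_at_apply)
    qed
  qed
  ultimately show ?thesis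
    by (auto simp: least_def)
qed

end
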